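(* Let $A$ be an integral domain with field of fractions $Q(A)$, let $p\in Q(A)$ be a plant and $\Theta\in Q(A)$ a signal generator. A controller $c\in Q(A)$ is robustly regulating for $p$ with the signal generator $\Theta$ if and only if $c$ stabilizes $p$ and there exist $\alpha,\beta\in A$ such that $\Theta=\alpha+\beta\, c$.
   Context: An integral domain is a commutative ring with unit $1$ and without zero divisors. A controller $c\in Q(A)$ stabilizes $p\in Q(A)$ if $1-pc\neq 0$ and $\frac{1}{1-pc},\ \frac{p}{1-pc},\ \frac{c}{1-pc}$ all belong to $A$. $\mathrm{Stab}(p)$ denotes the set of all stabilizing controllers of $p$; $c\in \mathrm{Stab}(p)$ is equivalent to $p\in\mathrm{Stab}(c)$. A controller $c$ is regulating $p$ with the signal generator $\Theta$ if $\Theta\,\frac{1}{1-pc}\in A$ and $\Theta\,\frac{p}{1-pc}\in A$. A controller $c$ is robustly regulating (for $p$, with signal generator $\Theta$) if (i) $c\in\mathrm{Stab}(p)$ and (ii) $c$ regulates every plant it stabilizes, i.e. for every $p'\in\mathrm{Stab}(c)$ one has $\Theta\,\frac{1}{1-p'c}\in A$ and $\Theta\,\frac{p'}{1-p'c}\in A$. *)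

theory Defs
  imports "HOL-Computational_Algebra.Polynomial_Factorial"
begin

text \<open>
  The integral domain \<open>A\<close> is a type \<open>'a :: idom\<close>, and \<open>Q(A)\<close> is \<open>'a fract\<close>;
  \<open>range to_fract\<close> is \<open>A\<close> regarded as a subring of \<open>Q(A)\<close>.
\<close>

definition stabilizes :: "'a::idom fract \<Rightarrow> 'a fract \<Rightarrow> bool" where
  "stabilizes c p \<longleftrightarrow> 1 - p * c \<noteq> 0 \<and>
     1 / (1 - p * c) \<in> range to_fract \<and>
     p / (1 - p * c) \<in> range to_fract \<and>
     c / (1 - p * c) \<in> range to_fract"

definition Stab :: "'a::idom fract \<Rightarrow> 'a fract set" where
  "Stab p = {c. stabilizes c p}"

text \<open>
  The condition \<open>1 - p * c \<noteq> 0\<close> makes explicit that the two fractions have to be defined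
  (in HOL, division by zero yields zero). It holds automatically for \<open>p \<in> Stab c\<close>.
\<close>

definition regulating :: "'a::idom fract \<Rightarrow> 'a fract \<Rightarrow> 'a fract \<Rightarrow> bool" where
  "regulating \<Theta> p c \<longleftrightarrow> 1 - p * c \<noteq> 0 \<and>
     \<Theta> * (1 / (1 - p * c)) \<in> range to_fract \<and>
     \<Theta> * (p / (1 - p * c)) \<in> range to_fract"

definition robustly_regulating :: "'a::idom fract \<Rightarrow> 'a fract \<Rightarrow> 'a fract \<Rightarrow> bool" where
  "robustly_regulating \<Theta> p c \<longleftrightarrow> c \<in> Stab p \<and> (\<forall>p'\<in>Stab c. regulating \<Theta> p' c)"

end

theory Submission
  imports Defs
begin

text \<open>
  Put \<open>a = 1/(1 - pc)\<close> and \<open>b = p/(1 - pc)\<close>, so that \<open>a - bc = 1\<close>.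
  If \<open>c\<close> is robustly regulating, then it regulates \<open>p\<close> itself, because stabilization is
  symmetric in plant and controller; hence \<open>\<Theta>a\<close> and \<open>\<Theta>b\<close> lie in \<open>A\<close>, and
  \<open>\<Theta> = \<Theta>a - (\<Theta>b)c\<close> is the required representation.

  Conversely, if \<open>p'\<close> is stabilized by \<open>c\<close>, then multiplication by \<open>1/(1 - p'c)\<close> and by
  \<open>p'/(1 - p'c)\<close> maps both \<open>1\<close> and \<open>c\<close> into \<open>A\<close>; the only product that is not part of the
  definition of stabilization is \<open>p'c/(1 - p'c) = 1/(1 - p'c) - 1\<close>. By linearity every
  element of \<open>A + Ac\<close> is mapped into \<open>A\<close> as well.
\<close>

lemma stabilizes_sym: "stabilizes c p \<longleftrightarrow> stabilizes p c"
  by (auto simp: stabilizes_def mult.commute)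

lemma range_to_fract_add:
  assumes "x \<in> range to_fract" "y \<in> range to_fract"
  shows "x + y \<in> range to_fract"
  using assms by (auto simp flip: to_fract_add)

lemma range_to_fract_diff:
  assumes "x \<in> range to_fract" "y \<in> range to_fract"
  shows "x - y \<in> range to_fract"
  using assms by (auto simp flip: to_fract_diff)

lemma range_to_fract_mult:
  assumes "x \<in> range to_fract" "y \<in> range to_fract"
  shows "x * y \<in> range to_fract"
  using assms by (auto simp flip: to_fract_mult)

lemma regulating_imp_signal_generator:
  fixes p \<Theta> c :: "'a::idom fract"
  assumes "regulating \<Theta> p c"
  shows "\<exists>\<alpha> \<beta> :: 'a. \<Theta> = to_fract \<alpha> + to_fract \<beta> * c"
proof -
  from assms have nz: "1 - p * c \<noteq> 0"
    by (simp add: regulating_def)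
  from assms obtain \<alpha> \<beta> :: 'a where \<alpha>: "\<Theta> * (1 / (1 - p * c)) = to_fract \<alpha>"
    and \<beta>: "\<Theta> * (p / (1 - p * c)) = to_fract \<beta>"
    by (auto simp: regulating_def)
  have "\<Theta> = \<Theta> * (1 / (1 - p * c)) - \<Theta> * (p / (1 - p * c)) * c"
    using nz by (simp add: divide_simps) (simp add: algebra_simps)
  also have "\<dots> = to_fract \<alpha> + to_fract (- \<beta>) * c"
    by (simp only: \<alpha> \<beta> to_fract_uminus) simp
  finally show ?thesis
    by blast
qed

lemma signal_generator_imp_regulating:
  fixes \<alpha> \<beta> :: "'a::idom"
  assumes "stabilizes c p"
  shows "regulating (to_fract \<alpha> + to_fract \<beta> * c) p c"
proof -
  let ?d = "1 - p * c"
  from assms have nz: "?d \<noteq> 0" and one: "1 / ?d \<in> range to_fract"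
    and p: "p / ?d \<in> range to_fract" and c: "c / ?d \<in> range to_fract"
    by (auto simp: stabilizes_def)
  have "p * c / ?d = 1 / ?d - 1"
    using nz by (simp add: field_simps)
  also have "\<dots> \<in> range to_fract"
    using range_to_fract_diff[OF one, of 1] by (metis rangeI to_fract_1)
  finally have pc: "p * c / ?d \<in> range to_fract" .
  have "to_fract \<alpha> * (1 / ?d) + to_fract \<beta> * (c / ?d) \<in> range to_fract"
    "to_fract \<alpha> * (p / ?d) + to_fract \<beta> * (p * c / ?d) \<in> range to_fract"
    by (intro range_to_fract_add range_to_fract_mult rangeI one p c pc)+
  with nz show ?thesis
    by (simp add: regulating_def add_divide_distrib distrib_left distrib_right mult_ac)
qed

theorem theorem3p2:
  fixes p \<Theta> c :: "'a::idom fract"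
  shows "robustly_regulating \<Theta> p c \<longleftrightarrow>
    stabilizes c p \<and> (\<exists>\<alpha> \<beta> :: 'a. \<Theta> = to_fract \<alpha> + to_fract \<beta> * c)"
proof
  assume "robustly_regulating \<Theta> p c"
  then have stab: "stabilizes c p" and reg: "\<And>p'. stabilizes p' c \<Longrightarrow> regulating \<Theta> p' c"
    by (auto simp: robustly_regulating_def Stab_def)
  from stab have "stabilizes p c"
    by (simp only: stabilizes_sym[of c p])
  with stab reg show "stabilizes c p \<and> (\<exists>\<alpha> \<beta> :: 'a. \<Theta> = to_fract \<alpha> + to_fract \<beta> * c)"
    by (blast intro: regulating_imp_signal_generator)
next
  assume *: "stabilizes c p \<and> (\<exists>\<alpha> \<beta> :: 'a. \<Theta> = to_fract \<alpha> + to_fract \<beta> * c)"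
  have "regulating \<Theta> p' c" if "stabilizes p' c" for p'
    using * that signal_generator_imp_regulating stabilizes_sym by blast
  with * show "robustly_regulating \<Theta> p c"
    by (auto simp: robustly_regulating_def Stab_def)
qed

end
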